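(* Let $i\in\{1,\dots,n\}$ be $n$ problem instances, let $A$ and $B$ be two optimization algorithms, and let $k\in\{0,\dots,n\}$ be an integer. Let $A_i$, $B_i$, $\hat B_i$ be the random performances on instance $i$ described in the context (with observed values $a_i$, $b_i$, $\hat b_i$), where $\hat B_i$ is obtained with an estimated runtime $\hat t_2$ in place of the true equivalent runtime $t_2$ used for $B_i$. Suppose that $A_i\neq B_i$ and $A_i\neq\hat B_i$ for every $i$. Assume, as throughout the setting, that whether $\hat t_2>t_2$ holds is independent for each instance $i$, that $\mathcal P[\hat t_2>t_2]<0.01$ for each instance, and that a longer runtime can only produce a lower or equal objective value, so that $\hat B_i<B_i$ implies $\hat t_2>t_2$ for instance $i$. Let $H_0$ be the null hypothesis under which the statistic $\#\{A_i<B_i\}$ follows the null distribution $Bin(n,0.5)$. Then $$\mathcal P\big[\#\{A_i<\hat B_i\}\le k \;\big|\; H_0\big]\;\le\;\sum_{v=0}^{n}\Big(1-\mathcal P\big[Bin(n,0.01)<\max(0,v-k)\big]\Big)\cdot\mathcal P\big[Bin(n,0.5)=v\big].$$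
   Context: For a condition $C_i$ depending on $i$, $\#\{C_i\}$ denotes the random number of indices $i\in\{1,\dots,n\}$ for which $C_i$ holds. $Bin(n,p)$ denotes a binomial random variable with $n$ trials and success probability $p$. All problems are minimization problems (a lower objective value is better). The performance of an algorithm on an instance $i$, in a given machine and with a given maximum runtime as stopping criterion, is the random variable obtained by sampling a random seed and then optimizing instance $i$ with that algorithm in that machine for that time; given the seed it is deterministic. Algorithm $A$ was run in a machine $M_1$ for time $t_1$ on instance $i$. The equivalent runtime $t_2$ is the time a second machine $M_2$ needs to replicate the same sequence of computational instructions, and $\hat t_2$ is an estimate of $t_2$ (both depend on the instance). $A_i$ is the performance of $A$ on instance $i$ in $M_1$ with runtime $t_1$ (the same random variable as in $M_2$ with runtime $t_2$). $B_i$ is the performance of $B$ on instance $i$ in $M_2$ with runtime $t_2$. $\hat B_i$ is the performance of $B$ on instance $i$ in $M_2$ with runtime $\hat t_2$. The number $0.01$ is the chosen upper bound on the probability of estimating a runtime longer than the true equivalent runtime. The right-hand side of the inequality is the corrected $p$-value of the one-sided sign test for this choice.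
   Formalization: Additionally assumes that which instances have an overestimated runtime (estimated t2 > true t2) is independent of which instances satisfy A_i < B_i; with independence across instances only, the bound fails (n=1, k=0: 0.509 > 0.505). *)

theory Defs
  imports "HOL-Probability.Probability"
begin

definition num_indices :: "nat \<Rightarrow> (nat \<Rightarrow> bool) \<Rightarrow> nat" where
  "num_indices n C = card {i \<in> {1..n}. C i}"

text \<open>
  Execution model: \<open>exec X m i s t\<close> is the sequence of computational instructions that
  algorithm \<open>X\<close> carries out on instance \<open>i\<close> with random seed \<open>s\<close> when it is run on machine
  \<open>m\<close> for time \<open>t\<close>; \<open>obj i is\<close> is the objective value (to be minimized) obtained on
  instance \<open>i\<close> after the instruction sequence \<open>is\<close>.
  Composing \<open>performance\<close> with a random seed gives the random performance.
\<close>

definition performance ::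
  "('alg \<Rightarrow> 'machine \<Rightarrow> nat \<Rightarrow> 'seed \<Rightarrow> real \<Rightarrow> 'instr list) \<Rightarrow> (nat \<Rightarrow> 'instr list \<Rightarrow> real)
    \<Rightarrow> 'alg \<Rightarrow> 'machine \<Rightarrow> nat \<Rightarrow> real \<Rightarrow> 'seed \<Rightarrow> real" where
  "performance exec obj X m i t s = obj i (exec X m i s t)"

text \<open>
  Running \<open>X\<close> on \<open>m2\<close> for time \<open>t2\<close> replicates the instruction sequence of running it on \<open>m1\<close>
  for time \<open>t1\<close>. The least such \<open>t2\<close> is the time that \<open>m2\<close> needs; minimality is not
  required here, so every time that replicates the sequence is admitted.
\<close>

definition equivalent_runtime ::
  "('alg \<Rightarrow> 'machine \<Rightarrow> nat \<Rightarrow> 'seed \<Rightarrow> real \<Rightarrow> 'instr list) \<Rightarrow> 'alg \<Rightarrow> nat \<Rightarrow> 'seed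
    \<Rightarrow> 'machine \<Rightarrow> real \<Rightarrow> 'machine \<Rightarrow> real \<Rightarrow> bool" where
  "equivalent_runtime exec X i s m1 t1 m2 t2 \<longleftrightarrow> exec X m2 i s t2 = exec X m1 i s t1"

definition sign_test_null ::
  "'w measure \<Rightarrow> nat \<Rightarrow> (nat \<Rightarrow> 'w \<Rightarrow> real) \<Rightarrow> (nat \<Rightarrow> 'w \<Rightarrow> real) \<Rightarrow> bool" where
  "sign_test_null P n A B \<longleftrightarrow>
     distr P (count_space UNIV) (\<lambda>\<omega>. num_indices n (\<lambda>i. A i \<omega> < B i \<omega>))
       = measure_pmf (binomial_pmf n (1/2))"

end

theory Submission
  imports Defs
begin

text \<open>
  An instance with \<open>A i < B i\<close> but not \<open>A i < Bhat i\<close> has \<open>Bhat i < B i\<close>, so its runtime was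
  overestimated. Hence the count for \<open>B\<close> exceeds the count for \<open>Bhat\<close> by at most the number of
  overestimated runtimes. That number is stochastically dominated by a binomial variable with
  success probability \<open>1/100\<close>, and conditioning on the count for \<open>B\<close>, which is independent of it,
  gives the bound.
\<close>

text \<open>Condition on the first of the \<open>Suc n\<close> trials: after a success the other
  \<open>n\<close> trials have to supply \<open>m\<close> more, after a failure
  \<open>Suc m\<close>. The inductive step of the domination bound below produces the same two-term
  recursion.\<close>

lemma prob_binomial_pmf_Suc_atLeast_Suc:
  assumes "p \<in> {0..1}"
  shows "measure_pmf.prob (binomial_pmf (Suc n) p) {Suc m..} =
    p * measure_pmf.prob (binomial_pmf n p) {m..} +
    (1 - p) * measure_pmf.prob (binomial_pmf n p) {Suc m..}"
proof -
  let ?B = "binomial_pmf n p"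
  \<comment> \<open>\<open>binomial_pmf_Suc\<close> unfolds to a bind over the first trial
    \<open>b\<close>. Reading the inner bind as the image under a shift by 0 or 1 reduces the tail
    to a preimage, which the next fact computes.\<close>
  have "?B \<bind> (\<lambda>k. return_pmf ((if b then 1 else 0) + k)) =
      map_pmf (\<lambda>k. (if b then 1 else 0) + k) ?B" for b
    by (simp add: map_pmf_def)
  moreover have "(\<lambda>k. (if b then 1 else 0) + k) -` {Suc m..} = (if b then {m..} else {Suc m..})" for b
    by auto
  ultimately have "emeasure (binomial_pmf (Suc n) p) {Suc m..} =
      ennreal p * emeasure ?B {m..} + ennreal (1 - p) * emeasure ?B {Suc m..}"
    using assms by (simp add: binomial_pmf_Suc mult.commute)
  also have "\<dots> = ennreal (p * measure_pmf.prob ?B {m..} + (1 - p) * measure_pmf.prob ?B {Suc m..})"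
    using assms by (simp add: measure_pmf.emeasure_eq_measure ennreal_mult'' ennreal_plus)
  finally show ?thesis
    using assms
    by (subst (asm) measure_pmf.emeasure_eq_measure) (simp add: ennreal_inj del: ennreal_plus)
qed

context prob_space
begin

text \<open>Each one-element family \<open>{E i}\<close> is closed under intersection, so
  independence of the events extends to the sigma-algebras they generate, and the indicator of
  \<open>E i\<close> is measurable with respect to the one generated by \<open>E i\<close>.\<close>

lemma indep_vars_indicator:
  assumes "indep_events E I"
  shows "indep_vars (\<lambda>_. borel) (\<lambda>i. indicator (E i) :: 'a \<Rightarrow> real) I"
proof -
  have events: "E i \<in> events" if "i \<in> I" for i
    using assms that by (auto simp: indep_events_def)
  have "indep_sets (\<lambda>i. sigma_sets (space M) {E i}) I"
    using assms by (intro indep_sets_sigma) (auto simp: indep_events_def_alt Int_stable_def)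
  moreover have "indicator (E i) -` S \<inter> space M \<in> sigma_sets (space M) {E i}"
    if "i \<in> I" "S \<in> sets borel" for i and S :: "real set"
  proof -
    have "E i \<in> sets (sigma (space M) {E i})"
      using sets.sets_into_space[OF events[OF that(1)]] by (simp add: sets_measure_of)
    then have "(indicator (E i) :: 'a \<Rightarrow> real) \<in> borel_measurable (sigma (space M) {E i})"
      by simp
    from measurable_sets[OF this that(2)] show ?thesis
      using sets.sets_into_space[OF events[OF that(1)]]
      by (simp add: sets_measure_of space_measure_of)
  qed
  ultimately have "indep_sets (\<lambda>i. {indicator (E i) -` S \<inter> space M | S :: real set. S \<in> sets borel}) I"
    by (elim indep_sets_mono_sets) auto
  then show ?thesis
    using events by (auto simp: indep_vars_def2)
qed

text \<open>The count over \<open>I\<close> is a sum of indicators, and such a sum is independent of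
  the indicator of the remaining event \<open>E x\<close>. The two events are the preimages of
  \<open>{1}\<close> and \<open>{real m..}\<close>.\<close>

lemma prob_Int_count_indep_events:
  assumes I: "finite I" "x \<notin> I" and indep: "indep_events E (insert x I)"
  shows "prob (E x \<inter> {\<omega> \<in> space M. m \<le> card {i \<in> I. \<omega> \<in> E i}}) =
    prob (E x) * prob {\<omega> \<in> space M. m \<le> card {i \<in> I. \<omega> \<in> E i}}"
proof -
  define N where "N = (\<lambda>\<omega>. \<Sum>i\<in>I. indicator (E i) \<omega> :: real)"
  have count: "N \<omega> = real (card {i \<in> I. \<omega> \<in> E i})" for \<omega>
    using I by (simp add: N_def indicator_def sum.If_cases Int_def)
  have sub: "E x \<subseteq> space M"
    using indep sets.sets_into_space by (auto simp: indep_events_def)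
  have "indep_var borel (indicator (E x) :: _ \<Rightarrow> real) borel N"
    unfolding N_def using I indep_vars_indicator[OF indep] by (rule indep_vars_sum)
  from indep_varD[OF this, of "{1}" "{real m..}"]
  have "prob ((\<lambda>\<omega>. (indicator (E x) \<omega> :: real, N \<omega>)) -` ({1} \<times> {real m..}) \<inter> space M) =
      prob (indicator (E x) -` {1 :: real} \<inter> space M) * prob (N -` {real m..} \<inter> space M)"
    by simp
  moreover have "(\<lambda>\<omega>. (indicator (E x) \<omega> :: real, N \<omega>)) -` ({1} \<times> {real m..}) \<inter> space M =
      E x \<inter> {\<omega> \<in> space M. m \<le> card {i \<in> I. \<omega> \<in> E i}}"
    using sub by (auto simp: count indicator_def split: if_splits)
  moreover have "indicator (E x) -` {1 :: real} \<inter> space M = E x"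
    using sub by (auto simp: indicator_def split: if_splits)
  moreover have "N -` {real m..} \<inter> space M = {\<omega> \<in> space M. m \<le> card {i \<in> I. \<omega> \<in> E i}}"
    by (auto simp: count)
  ultimately show ?thesis by simp
qed

text \<open>Stochastic domination by adding one event at a time. The threshold \<open>m\<close>
  stays arbitrary because the step for \<open>Suc l\<close> uses the smaller family at both
  \<open>l\<close> and \<open>Suc l\<close>.\<close>

lemma prob_count_indep_events_le_binomial:
  assumes "finite I" and "indep_events E I" and "\<And>i. i \<in> I \<Longrightarrow> prob (E i) \<le> p"
    and p: "p \<in> {0..1}"
  shows "prob {\<omega> \<in> space M. m \<le> card {i \<in> I. \<omega> \<in> E i}} \<le>
    measure_pmf.prob (binomial_pmf (card I) p) {m..}"
  using assms(1-3)
proof (induction I arbitrary: m rule: finite_induct)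
  case empty
  show ?case
    using p by (cases m) (auto simp: binomial_pmf_0 prob_space)
next
  case (insert x I)
  define F where "F l = {\<omega> \<in> space M. l \<le> card {i \<in> I. \<omega> \<in> E i}}" for l
  define G where "G l = measure_pmf.prob (binomial_pmf (card I) p) {l..}" for l
  have indep: "indep_events E I"
    using insert.prems(1) by (auto simp: indep_events_def)
  have Ex: "E x \<in> events" and EI: "\<And>i. i \<in> I \<Longrightarrow> E i \<in> events"
    using insert.prems(1) by (auto simp: indep_events_def)
  have F_events [measurable]: "F l \<in> events" for l
  proof -
    have "F l = {\<omega> \<in> space M. real l \<le> (\<Sum>i\<in>I. indicator (E i) \<omega>)}"
      using insert.hyps by (simp add: F_def indicator_def sum.If_cases Int_def)
    moreover have "(\<lambda>\<omega>. \<Sum>i\<in>I. indicator (E i) \<omega> :: real) \<in> borel_measurable M"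
      using EI by (intro borel_measurable_sum) auto
    ultimately show ?thesis by simp
  qed
  have FG: "prob (F l) \<le> G l" for l
    unfolding F_def G_def using insert.IH[OF indep] insert.prems(2) by auto
  show ?case
  proof (cases m)
    case 0
    then show ?thesis by (simp add: prob_space)
  next
    case (Suc l)
    have card_Suc: "card {i \<in> insert x I. \<omega> \<in> E i} =
        (if \<omega> \<in> E x then Suc (card {i \<in> I. \<omega> \<in> E i}) else card {i \<in> I. \<omega> \<in> E i})" for \<omega>
    proof -
      have "{i \<in> insert x I. \<omega> \<in> E i} =
          (if \<omega> \<in> E x then insert x {i \<in> I. \<omega> \<in> E i} else {i \<in> I. \<omega> \<in> E i})"
        by auto
      then show ?thesis using insert.hyps by simp
    qed
    have mono: "F (Suc l) \<subseteq> F l"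
      by (auto simp: F_def)
    \<comment> \<open>Split by whether \<open>E x\<close> occurs. The second part is written as a
      difference inside \<open>F (Suc l)\<close>, so that independence is only needed for
      intersections with \<open>E x\<close> itself, not with its complement.\<close>
    have "{\<omega> \<in> space M. Suc l \<le> card {i \<in> insert x I. \<omega> \<in> E i}} =
        (E x \<inter> F l) \<union> (F (Suc l) - E x \<inter> F (Suc l))"
      unfolding card_Suc F_def using sets.sets_into_space[OF Ex] by (auto split: if_splits)
    also have "prob \<dots> = prob (E x \<inter> F l) + prob (F (Suc l) - E x \<inter> F (Suc l))"
      using Ex by (intro finite_measure_Union) auto
    also have "prob (F (Suc l) - E x \<inter> F (Suc l)) = prob (F (Suc l)) - prob (E x \<inter> F (Suc l))"
      using Ex by (intro finite_measure_Diff) auto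
    also have "prob (E x \<inter> F l) + (prob (F (Suc l)) - prob (E x \<inter> F (Suc l))) =
        prob (F (Suc l)) + prob (E x) * (prob (F l) - prob (F (Suc l)))"
      unfolding F_def prob_Int_count_indep_events[OF insert.hyps insert.prems(1)]
      by (simp add: algebra_simps)
    \<comment> \<open>The factor of \<open>prob (E x)\<close> is nonnegative by \<open>mono\<close>,
      so raising \<open>prob (E x)\<close> to \<open>p\<close> can only increase the expression.
      What results is a convex combination, to which the induction hypothesis applies
      termwise.\<close>
    also have "\<dots> \<le> prob (F (Suc l)) + p * (prob (F l) - prob (F (Suc l)))"
      using insert.prems(2)[of x] finite_measure_mono[OF mono]
      by (intro add_left_mono mult_right_mono) auto
    also have "\<dots> = p * prob (F l) + (1 - p) * prob (F (Suc l))"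
      by (simp add: algebra_simps)
    also have "\<dots> \<le> p * G l + (1 - p) * G (Suc l)"
      using p FG by (intro add_mono mult_left_mono) auto
    also have "\<dots> = measure_pmf.prob (binomial_pmf (card (insert x I)) p) {Suc l..}"
      using insert.hyps p by (simp add: prob_binomial_pmf_Suc_atLeast_Suc G_def)
    finally show ?thesis by (simp add: Suc)
  qed
qed

end

theorem theorem1:
  fixes P :: "'w measure"
    and n k :: nat
    and exec :: "'alg \<Rightarrow> 'machine \<Rightarrow> nat \<Rightarrow> 'seed \<Rightarrow> real \<Rightarrow> 'instr list"
    and obj :: "nat \<Rightarrow> 'instr list \<Rightarrow> real"
    and algA algB :: 'alg
    and m1 m2 :: 'machine
    and seedA seedB :: "nat \<Rightarrow> 'w \<Rightarrow> 'seed"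
    and t1 :: "nat \<Rightarrow> real"
    and t2 t2hat :: "nat \<Rightarrow> 'w \<Rightarrow> real"
    and A B Bhat :: "nat \<Rightarrow> 'w \<Rightarrow> real"
  assumes prob: "prob_space P"
    and k: "k \<in> {0..n}"
    and A_def: "\<And>i \<omega>. i \<in> {1..n} \<Longrightarrow> \<omega> \<in> space P \<Longrightarrow>
      A i \<omega> = performance exec obj algA m1 i (t1 i) (seedA i \<omega>)"
    and B_def: "\<And>i \<omega>. i \<in> {1..n} \<Longrightarrow> \<omega> \<in> space P \<Longrightarrow>
      B i \<omega> = performance exec obj algB m2 i (t2 i \<omega>) (seedB i \<omega>)"
    and Bhat_def: "\<And>i \<omega>. i \<in> {1..n} \<Longrightarrow> \<omega> \<in> space P \<Longrightarrow>
      Bhat i \<omega> = performance exec obj algB m2 i (t2hat i \<omega>) (seedB i \<omega>)"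
    and equiv: "\<And>i \<omega>. i \<in> {1..n} \<Longrightarrow> \<omega> \<in> space P \<Longrightarrow>
      equivalent_runtime exec algA i (seedA i \<omega>) m1 (t1 i) m2 (t2 i \<omega>)"
    and rv_perf: "\<And>i. i \<in> {1..n} \<Longrightarrow>
      A i \<in> borel_measurable P \<and> B i \<in> borel_measurable P \<and> Bhat i \<in> borel_measurable P"
    and rv_time: "\<And>i. i \<in> {1..n} \<Longrightarrow>
      t2 i \<in> borel_measurable P \<and> t2hat i \<in> borel_measurable P"
    and time_nonneg: "\<And>i \<omega>. i \<in> {1..n} \<Longrightarrow> \<omega> \<in> space P \<Longrightarrow>
      0 \<le> t1 i \<and> 0 \<le> t2 i \<omega> \<and> 0 \<le> t2hat i \<omega>"
    and no_ties: "\<And>i. i \<in> {1..n} \<Longrightarrow> AE \<omega> in P. A i \<omega> \<noteq> B i \<omega> \<and> A i \<omega> \<noteq> Bhat i \<omega>"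
    and longer_not_worse: "\<And>X m i s t t'. i \<in> {1..n} \<Longrightarrow> 0 \<le> t \<Longrightarrow> t \<le> t' \<Longrightarrow>
      performance exec obj X m i t' s \<le> performance exec obj X m i t s"
    and overestimate_prob: "\<And>i. i \<in> {1..n} \<Longrightarrow>
      measure P {\<omega> \<in> space P. t2hat i \<omega> > t2 i \<omega>} < 1/100"
    and overestimate_indep: "prob_space.indep_events P
      (\<lambda>i. {\<omega> \<in> space P. t2hat i \<omega> > t2 i \<omega>}) {1..n}"
    and overestimate_indep_outcomes: "prob_space.indep_var P
      (count_space UNIV) (\<lambda>\<omega>. {i \<in> {1..n}. t2hat i \<omega> > t2 i \<omega>})
      (count_space UNIV) (\<lambda>\<omega>. {i \<in> {1..n}. A i \<omega> < B i \<omega>})"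
    and H0: "sign_test_null P n A B"
  shows "measure P {\<omega> \<in> space P. num_indices n (\<lambda>i. A i \<omega> < Bhat i \<omega>) \<le> k}
    \<le> (\<Sum>v = 0..n.
         (1 - measure_pmf.prob (binomial_pmf n (1/100)) {w. int w < max 0 (int v - int k)})
         * pmf (binomial_pmf n (1/2)) v)"
proof -
  interpret prob_space P by (rule prob)
  define T where "T \<omega> = {i \<in> {1..n}. t2hat i \<omega> > t2 i \<omega>}" for \<omega>
  define V where "V \<omega> = {i \<in> {1..n}. A i \<omega> < B i \<omega>}" for \<omega>
  define W where "W \<omega> = {i \<in> {1..n}. A i \<omega> < Bhat i \<omega>}" for \<omega>
  define E where "E i = {\<omega> \<in> space P. t2hat i \<omega> > t2 i \<omega>}" for i
  have indep: "indep_var (count_space UNIV) T (count_space UNIV) V"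
    using overestimate_indep_outcomes unfolding T_def V_def .
  have T [measurable]: "T \<in> P \<rightarrow>\<^sub>M count_space UNIV"
    and V [measurable]: "V \<in> P \<rightarrow>\<^sub>M count_space UNIV"
    using indep_var_rv1[OF indep] indep_var_rv2[OF indep] .
  have V_le: "card (V \<omega>) \<le> n" for \<omega>
    using card_mono[of "{1..n}" "V \<omega>"] by (simp add: V_def subset_eq)
  have diff: "card (V \<omega>) \<le> card (W \<omega>) + card (T \<omega>)" if \<omega>: "\<omega> \<in> space P" for \<omega>
  proof -
    \<comment> \<open>\<open>B\<close> and \<open>Bhat\<close> share the seed \<open>seedB\<close>,
      so the comparison is pointwise: here \<open>t2hat\<close> is the shorter runtime and
      \<open>t2\<close> the longer one.\<close>
    have "Bhat i \<omega> \<ge> B i \<omega>" if i: "i \<in> {1..n}" and "\<not> t2 i \<omega> < t2hat i \<omega>" for i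
      using longer_not_worse[OF i, of "t2hat i \<omega>" "t2 i \<omega>"] time_nonneg[OF i \<omega>] that
      by (simp add: B_def[OF i \<omega>] Bhat_def[OF i \<omega>])
    then have "V \<omega> \<subseteq> W \<omega> \<union> T \<omega>"
      by (force simp: V_def W_def T_def)
    then have "card (V \<omega>) \<le> card (W \<omega> \<union> T \<omega>)"
      by (intro card_mono) (auto simp: W_def T_def)
    also have "\<dots> \<le> card (W \<omega>) + card (T \<omega>)"
      by (rule card_Un_le)
    finally show ?thesis .
  qed
  have prob_V: "prob ((\<lambda>\<omega>. card (V \<omega>)) -` {v} \<inter> space P) = pmf (binomial_pmf n (1/2)) v" for v
  proof -
    have "(\<lambda>\<omega>. num_indices n (\<lambda>i. A i \<omega> < B i \<omega>)) = (\<lambda>\<omega>. card (V \<omega>))"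
      by (simp add: num_indices_def V_def)
    with H0 have "measure (distr P (count_space UNIV) (\<lambda>\<omega>. card (V \<omega>))) {v} =
        measure_pmf.prob (binomial_pmf n (1/2)) {v}"
      by (simp add: sign_test_null_def)
    then show ?thesis
      by (subst (asm) measure_distr) (auto simp: measure_pmf_single)
  qed
  have prob_T: "prob ((\<lambda>\<omega>. card (T \<omega>)) -` {m..} \<inter> space P) \<le>
      measure_pmf.prob (binomial_pmf n (1/100)) {m..}" for m
  proof -
    have "(\<lambda>\<omega>. card (T \<omega>)) -` {m..} \<inter> space P =
        {\<omega> \<in> space P. m \<le> card {i \<in> {1..n}. \<omega> \<in> E i}}"
      by (auto simp: T_def E_def cong: conj_cong)
    moreover have "prob {\<omega> \<in> space P. m \<le> card {i \<in> {1..n}. \<omega> \<in> E i}} \<le>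
        measure_pmf.prob (binomial_pmf (card {1..n}) (1/100)) {m..}"
    proof (rule prob_count_indep_events_le_binomial)
      show "indep_events E {1..n}"
        using overestimate_indep unfolding E_def .
      show "prob (E i) \<le> 1/100" if "i \<in> {1..n}" for i
        using overestimate_prob[OF that] by (simp add: E_def)
    qed auto
    ultimately show ?thesis by simp
  qed
  \<comment> \<open>Subtraction on naturals truncates, so \<open>v - k\<close> is already max(0, v -
    k); for v \<le> k the condition on \<open>T\<close> is vacuous.\<close>
  define D where "D v = {\<omega> \<in> space P. card (V \<omega>) = v \<and> v - k \<le> card (T \<omega>)}" for v
  have D_events: "D v \<in> events" for v
    unfolding D_def by measurable
  have prob_D: "prob (D v) = prob ((\<lambda>\<omega>. card (T \<omega>)) -` {v - k..} \<inter> space P) *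
      pmf (binomial_pmf n (1/2)) v" for v
  proof -
    \<comment> \<open>Independence is assumed for the random index sets. Both cardinality conditions
      define sets of index sets, so \<open>D v\<close> is the preimage of a rectangle and its
      probability factors.\<close>
    have "D v = (\<lambda>\<omega>. (T \<omega>, V \<omega>)) -` ({S. v - k \<le> card S} \<times> {S. card S = v}) \<inter> space P"
      by (auto simp: D_def)
    then have "prob (D v) = prob (T -` {S. v - k \<le> card S} \<inter> space P) *
        prob (V -` {S. card S = v} \<inter> space P)"
      using indep_varD[OF indep, of "{S. v - k \<le> card S}" "{S. card S = v}"] by simp
    moreover have "T -` {S. v - k \<le> card S} = (\<lambda>\<omega>. card (T \<omega>)) -` {v - k..}"
      "V -` {S. card S = v} = (\<lambda>\<omega>. card (V \<omega>)) -` {v}"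
      by auto
    ultimately show ?thesis
      by (simp only: prob_V)
  qed
  \<comment> \<open>The strict lower tail with integer \<open>max\<close> is the complement of the
    closed upper tail at the truncated difference.\<close>
  have tail: "1 - measure_pmf.prob (binomial_pmf n (1/100)) {w. int w < max 0 (int v - int k)} =
      measure_pmf.prob (binomial_pmf n (1/100)) {v - k..}" for v
  proof -
    have "UNIV - {v - k..} = {w. int w < max 0 (int v - int k)}"
      by auto
    then show ?thesis
      using measure_pmf.prob_compl[of "{v - k..}" "binomial_pmf n (1/100)"] by simp
  qed
  \<comment> \<open>The index of the covering set is the observed count
    \<open>card (V \<omega>)\<close>: if \<open>card (W \<omega>)\<close> is at most
    \<open>k\<close>, then \<open>diff\<close> forces at least \<open>card (V \<omega>) - k\<close>
    overestimated runtimes.\<close>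
  have "{\<omega> \<in> space P. num_indices n (\<lambda>i. A i \<omega> < Bhat i \<omega>) \<le> k} \<subseteq> (\<Union>v\<in>{0..n}. D v)"
  proof
    fix \<omega>
    assume "\<omega> \<in> {\<omega> \<in> space P. num_indices n (\<lambda>i. A i \<omega> < Bhat i \<omega>) \<le> k}"
    then have \<omega>: "\<omega> \<in> space P" and "card (W \<omega>) \<le> k"
      by (simp_all add: num_indices_def W_def)
    with diff[OF \<omega>] have "\<omega> \<in> D (card (V \<omega>))"
      by (simp add: D_def)
    with V_le[of \<omega>] show "\<omega> \<in> (\<Union>v\<in>{0..n}. D v)"
      by auto
  qed
  then have "prob {\<omega> \<in> space P. num_indices n (\<lambda>i. A i \<omega> < Bhat i \<omega>) \<le> k} \<le>
      prob (\<Union>v\<in>{0..n}. D v)"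
    using D_events by (intro finite_measure_mono) auto
  also have "\<dots> \<le> (\<Sum>v = 0..n. prob (D v))"
    using D_events by (intro finite_measure_subadditive_finite) auto
  also have "\<dots> \<le> (\<Sum>v = 0..n. measure_pmf.prob (binomial_pmf n (1/100)) {v - k..} *
      pmf (binomial_pmf n (1/2)) v)"
    unfolding prob_D by (intro sum_mono mult_right_mono prob_T) simp
  finally show ?thesis
    by (simp only: tail)
qed

end
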